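(* Let $\mathcal{A}$ be a finite-dimensional algebra over a field $\mathbb{F}$. (1) Assume that for all $a, b \in \mathcal{A}$ we have $(ab)a,\ a(ba) \in \mathcal{L}_1(a,b,aa,ab,ba)$, and the coefficient at $aa$ depends only on $b$; in other words, each of $(ab)a$ and $a(ba)$ can be represented as $$f_1(a,b)a + f_2(a,b)b + g(b)aa + f_3(a,b)ab + f_4(a,b)ba + f_5(a,b)e$$ for some functions $f_j: \mathcal{A} \times \mathcal{A} \to \mathbb{F}$, $j = 1, \dots, 5$, and $g: \mathcal{A} \to \mathbb{F}$ (where, if $\mathcal{A}$ is non-unital, $f_5(a,b) = 0$ for all $a,b \in \mathcal{A}$, i.e. the last term is absent). Then $\mathcal{A}$ is descendingly flexible. (2) If for all $a, b \in \mathcal{A}$ it holds that $(ba)a,\ a(ab) \in \mathcal{L}_1(a,b,aa,ab,ba)$, and the coefficient at $aa$ depends only on $b$ (in the same sense), then $\mathcal{A}$ is descendingly alternative.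
   Context: $\mathcal{A}$ is possibly non-unital and non-associative. If $\mathcal{A}$ is unital, its unity is denoted by $e$. For $a,b,c\in\mathcal{A}$ let $\mathcal{L}'_2(a,b,c)$ be the span of $a,b,c,ab,ba,cb,bc,ac,ca$ (together with $e$ if $\mathcal{A}$ is unital), and let $\mathcal{L}_1(a,b,aa,ab,ba)$ be the span of $a,b,aa,ab,ba$ (together with $e$ if $\mathcal{A}$ is unital). $\mathcal{A}$ is descendingly flexible if for all $a,b,c\in\mathcal{A}$: $(ab)a,\ a(ba) \in \mathcal{L}_1(a,b,aa,ab,ba)$; $(ab)c+(cb)a\in\mathcal{L}'_2(a,b,c)$; $a(bc)+c(ba)\in\mathcal{L}'_2(a,b,c)$. $\mathcal{A}$ is descendingly alternative if for all $a,b,c\in\mathcal{A}$: $(ba)a,\ a(ab) \in \mathcal{L}_1(a,b,aa,ab,ba)$; $(ab)c+(ac)b\in\mathcal{L}'_2(a,b,c)$; $a(bc)+b(ac)\in\mathcal{L}'_2(a,b,c)$. *)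

theory Defs
  imports Complex_Main
begin

text \<open>The carrier of the algebra is the whole type \<open>'a\<close>. The multiplication is only assumed to be
  bilinear: neither associativity nor a unity is required.\<close>

locale nonassoc_algebra = vector_space scale
  for scale :: "'f::field \<Rightarrow> 'a::ab_group_add \<Rightarrow> 'a" (infixr \<open>*s\<close> 75) +
  fixes mult :: "'a \<Rightarrow> 'a \<Rightarrow> 'a" (infixl \<open>\<bullet>\<close> 78)
  assumes linear_mult_left: "Vector_Spaces.linear scale scale (\<lambda>x. x \<bullet> y)"
    and linear_mult_right: "Vector_Spaces.linear scale scale (\<lambda>y. x \<bullet> y)"
begin

definition is_unity :: "'a \<Rightarrow> bool" where
  "is_unity u \<longleftrightarrow> (\<forall>x. u \<bullet> x = x \<and> x \<bullet> u = x)"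

definition unital :: bool where
  "unital \<longleftrightarrow> (\<exists>u. is_unity u)"

text \<open>Meaningful only if the algebra is unital; an arbitrary element otherwise.\<close>

definition unity :: 'a where
  "unity = (THE u. is_unity u)"

lemma is_unity_unique: "is_unity u \<Longrightarrow> is_unity v \<Longrightarrow> u = v"
  unfolding is_unity_def by metis

lemma is_unity_unity: "unital \<Longrightarrow> is_unity unity"
  unfolding unital_def unity_def by (metis is_unity_unique theI)

definition L1 :: "'a \<Rightarrow> 'a \<Rightarrow> 'a set" where
  "L1 a b = span ({a, b, a \<bullet> a, a \<bullet> b, b \<bullet> a} \<union> (if unital then {unity} else {}))"

text \<open>Squares are deliberately absent from the next spanning set.\<close>

definition L2' :: "'a \<Rightarrow> 'a \<Rightarrow> 'a \<Rightarrow> 'a set" where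
  "L2' a b c =
    span ({a, b, c, a \<bullet> b, b \<bullet> a, c \<bullet> b, b \<bullet> c, a \<bullet> c, c \<bullet> a} \<union> (if unital then {unity} else {}))"

definition descendingly_flexible :: bool where
  "descendingly_flexible \<longleftrightarrow>
    (\<forall>a b c. (a \<bullet> b) \<bullet> a \<in> L1 a b \<and> a \<bullet> (b \<bullet> a) \<in> L1 a b \<and>
      (a \<bullet> b) \<bullet> c + (c \<bullet> b) \<bullet> a \<in> L2' a b c \<and>
      a \<bullet> (b \<bullet> c) + c \<bullet> (b \<bullet> a) \<in> L2' a b c)"

definition descendingly_alternative :: bool where
  "descendingly_alternative \<longleftrightarrow>
    (\<forall>a b c. (b \<bullet> a) \<bullet> a \<in> L1 a b \<and> a \<bullet> (a \<bullet> b) \<in> L1 a b \<and>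
      (a \<bullet> b) \<bullet> c + (a \<bullet> c) \<bullet> b \<in> L2' a b c \<and>
      a \<bullet> (b \<bullet> c) + b \<bullet> (a \<bullet> c) \<in> L2' a b c)"

text \<open>\<open>p a b\<close> lies in \<open>L1 a b\<close> for all \<open>a\<close> and \<open>b\<close>, with a coefficient \<open>g b\<close> at \<open>a \<bullet> a\<close> that
  depends only on \<open>b\<close>. In the non-unital case the last summand vanishes.\<close>

definition L1_valued_uniform_square :: "('a \<Rightarrow> 'a \<Rightarrow> 'a) \<Rightarrow> bool" where
  "L1_valued_uniform_square p \<longleftrightarrow>
    (\<exists>(f1 :: 'a \<Rightarrow> 'a \<Rightarrow> 'f) (f2 :: 'a \<Rightarrow> 'a \<Rightarrow> 'f) (g :: 'a \<Rightarrow> 'f)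
      (f3 :: 'a \<Rightarrow> 'a \<Rightarrow> 'f) (f4 :: 'a \<Rightarrow> 'a \<Rightarrow> 'f) (f5 :: 'a \<Rightarrow> 'a \<Rightarrow> 'f).
      (\<not> unital \<longrightarrow> (\<forall>a b. f5 a b = 0)) \<and>
      (\<forall>a b. p a b = f1 a b *s a + f2 a b *s b + g b *s (a \<bullet> a)
        + f3 a b *s (a \<bullet> b) + f4 a b *s (b \<bullet> a) + f5 a b *s unity))"

lemma L1_valued_uniform_square_in_L1:
  assumes "L1_valued_uniform_square p"
  shows "p a b \<in> L1 a b"
proof -
  obtain x1 x2 x3 x4 x5 x6 where x6: "\<not> unital \<longrightarrow> x6 = 0"
    and p: "p a b = x1 *s a + x2 *s b + x3 *s (a \<bullet> a) + x4 *s (a \<bullet> b) + x5 *s (b \<bullet> a) + x6 *s unity"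
    using assms unfolding L1_valued_uniform_square_def by metis
  have "x6 *s unity \<in> L1 a b"
    using x6 by (cases unital) (auto simp: L1_def intro: span_scale span_base span_zero)
  moreover have "x1 *s a + x2 *s b + x3 *s (a \<bullet> a) + x4 *s (a \<bullet> b) + x5 *s (b \<bullet> a) \<in> L1 a b"
    unfolding L1_def by (intro span_add span_scale span_base) simp_all
  ultimately show ?thesis
    unfolding p by (auto simp: L1_def intro: span_add)
qed

end

end

theory Submission
  imports Defs
begin

text \<open>Let \<open>p a b\<close> be one of the cubic products, such as \<open>(a \<bullet> b) \<bullet> a\<close>. For fixed \<open>b\<close> the map
  \<open>a \<mapsto> p a b\<close> is quadratic, and the coefficient \<open>g b\<close> at \<open>a \<bullet> a\<close> is the
  same at \<open>a\<close>, \<open>c\<close> and \<open>a + c\<close>. Hence in the polarization \<open>p (a + c) b - p a b - p c b\<close> the squares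
  \<open>a \<bullet> a\<close> and \<open>c \<bullet> c\<close> cancel, leaving only \<open>g b *s (a \<bullet> c + c \<bullet> a)\<close> besides the other generators.\<close>

context nonassoc_algebra
begin

lemma mult_add_left: "(x + y) \<bullet> z = x \<bullet> z + y \<bullet> z"
  using linear_mult_left[of z] by (rule Vector_Spaces.linear.axioms(3)[THEN module_hom.add])

lemma mult_add_right: "x \<bullet> (y + z) = x \<bullet> y + x \<bullet> z"
  using linear_mult_right[of x] by (rule Vector_Spaces.linear.axioms(3)[THEN module_hom.add])

text \<open>Together with \<open>L2'_swap_left\<close> this gives invariance under every permutation
  of the arguments: the two transpositions generate them all.\<close>

lemma L2'_swap_outer: "L2' a b c = L2' c b a"
  unfolding L2'_def by (rule arg_cong[where f = span]) auto

lemma L2'_swap_left: "L2' a b c = L2' b a c"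
  unfolding L2'_def by (rule arg_cong[where f = span]) auto

text \<open>Keeping \<open>p\<close> and its mixed part \<open>q\<close> abstract lets one argument
  serve all four cubic products. The element held fixed sits in the middle of
  \<open>L2' a b c\<close>.\<close>

lemma L2'_polarization:
  assumes p: "L1_valued_uniform_square p"
    and q: "p (a + c) b = p a b + p c b + q"
  shows "q \<in> L2' a b c"
proof -
  let ?V = "L2' a b c"
  obtain f1 f2 g f3 f4 f5 where f5: "\<not> unital \<longrightarrow> (\<forall>a b. f5 a b = 0)"
    and p_eq: "\<And>a b. p a b = f1 a b *s a + f2 a b *s b + g b *s (a \<bullet> a)
        + f3 a b *s (a \<bullet> b) + f4 a b *s (b \<bullet> a) + f5 a b *s unity"
    using p unfolding L1_valued_uniform_square_def by metis
  have gens: "a \<in> ?V" "b \<in> ?V" "c \<in> ?V" "a \<bullet> b \<in> ?V" "b \<bullet> a \<in> ?V" "c \<bullet> b \<in> ?V" "b \<bullet> c \<in> ?V"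
    "a \<bullet> c \<in> ?V" "c \<bullet> a \<in> ?V"
    unfolding L2'_def by (simp_all add: span_base)
  \<comment> \<open>Without a unity, \<open>unity\<close> is an unspecified element, and membership
    holds only because \<open>f5\<close> vanishes.\<close>
  have unity: "f5 x b *s unity \<in> ?V" for x
    using f5 by (cases unital) (auto simp: L2'_def intro: span_scale span_base span_zero)
  \<comment> \<open>The square is the only term of \<open>p x b\<close> that may leave
    \<open>?V\<close>. This is applied with \<open>x\<close> equal to \<open>a\<close>,
    \<open>c\<close> and \<open>a + c\<close>.\<close>
  have mod_square: "p x b - g b *s (x \<bullet> x) \<in> ?V" if "x \<in> ?V" "x \<bullet> b \<in> ?V" "b \<bullet> x \<in> ?V" for x
  proof -
    have "p x b - g b *s (x \<bullet> x)
        = f1 x b *s x + f2 x b *s b + f3 x b *s (x \<bullet> b) + f4 x b *s (b \<bullet> x) + f5 x b *s unity"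
      unfolding p_eq by simp
    also have "\<dots> \<in> ?V"
      using that gens(2) unity[of x] unfolding L2'_def by (auto intro!: span_add intro: span_scale)
    finally show ?thesis .
  qed
  have "p (a + c) b - g b *s ((a + c) \<bullet> (a + c)) \<in> ?V"
    by (rule mod_square) (use gens in \<open>auto simp: L2'_def mult_add_left mult_add_right intro: span_add\<close>)
  moreover have "p a b - g b *s (a \<bullet> a) \<in> ?V" "p c b - g b *s (c \<bullet> c) \<in> ?V"
    using gens by (auto intro: mod_square)
  moreover have "g b *s (a \<bullet> c + c \<bullet> a) \<in> ?V"
    using gens unfolding L2'_def by (intro span_scale span_add)
  \<comment> \<open>The last summand cancels the cross terms of
    \<open>(a + c) \<bullet> (a + c)\<close>, all with the same coefficient
    \<open>g b\<close>.\<close>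
  ultimately have "(p (a + c) b - g b *s ((a + c) \<bullet> (a + c))) - (p a b - g b *s (a \<bullet> a))
      - (p c b - g b *s (c \<bullet> c)) + g b *s (a \<bullet> c + c \<bullet> a) \<in> ?V"
    unfolding L2'_def by (blast intro: span_add span_diff)
  also have "(p (a + c) b - g b *s ((a + c) \<bullet> (a + c))) - (p a b - g b *s (a \<bullet> a))
      - (p c b - g b *s (c \<bullet> c)) + g b *s (a \<bullet> c + c \<bullet> a) = q"
    unfolding q by (simp add: mult_add_left mult_add_right scale_right_distrib)
  finally show ?thesis .
qed

lemma descendingly_flexibleI:
  assumes "L1_valued_uniform_square (\<lambda>a b. (a \<bullet> b) \<bullet> a)"
    and "L1_valued_uniform_square (\<lambda>a b. a \<bullet> (b \<bullet> a))"
  shows descendingly_flexible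
  unfolding descendingly_flexible_def
proof (intro allI conjI)
  fix a b c
  show "(a \<bullet> b) \<bullet> a \<in> L1 a b" "a \<bullet> (b \<bullet> a) \<in> L1 a b"
    using assms[THEN L1_valued_uniform_square_in_L1, where a = a and b = b] by simp_all
  show "(a \<bullet> b) \<bullet> c + (c \<bullet> b) \<bullet> a \<in> L2' a b c"
    by (rule L2'_polarization[OF assms(1)]) (simp add: mult_add_left mult_add_right)
  show "a \<bullet> (b \<bullet> c) + c \<bullet> (b \<bullet> a) \<in> L2' a b c"
    by (rule L2'_polarization[OF assms(2)]) (simp add: mult_add_left mult_add_right)
qed

lemma descendingly_alternativeI:
  assumes "L1_valued_uniform_square (\<lambda>a b. (b \<bullet> a) \<bullet> a)"
    and "L1_valued_uniform_square (\<lambda>a b. a \<bullet> (a \<bullet> b))"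
  shows descendingly_alternative
  unfolding descendingly_alternative_def
proof (intro allI conjI)
  fix a b c
  show "(b \<bullet> a) \<bullet> a \<in> L1 a b" "a \<bullet> (a \<bullet> b) \<in> L1 a b"
    using assms[THEN L1_valued_uniform_square_in_L1, where a = a and b = b] by simp_all
  \<comment> \<open>Here \<open>b\<close> and \<open>c\<close> are polarized and \<open>a\<close> is
    fixed, so \<open>a\<close> comes out in the middle.\<close>
  have "(a \<bullet> b) \<bullet> c + (a \<bullet> c) \<bullet> b \<in> L2' b a c"
    by (rule L2'_polarization[OF assms(1)]) (simp add: mult_add_left mult_add_right)
  then show "(a \<bullet> b) \<bullet> c + (a \<bullet> c) \<bullet> b \<in> L2' a b c"
    by (simp only: L2'_swap_left[of a b c])
  \<comment> \<open>Now \<open>c\<close> is the fixed element; three swaps restore the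
    order.\<close>
  have "a \<bullet> (b \<bullet> c) + b \<bullet> (a \<bullet> c) \<in> L2' a c b"
    by (rule L2'_polarization[OF assms(2)]) (simp add: mult_add_left mult_add_right)
  also have "L2' a c b = L2' c a b"
    by (rule L2'_swap_left)
  also have "\<dots> = L2' b a c"
    by (rule L2'_swap_outer)
  also have "\<dots> = L2' a b c"
    by (rule L2'_swap_left)
  finally show "a \<bullet> (b \<bullet> c) + b \<bullet> (a \<bullet> c) \<in> L2' a b c" .
qed

end

theorem proposition3p3:
  fixes scale :: "'f::field \<Rightarrow> 'a::ab_group_add \<Rightarrow> 'a"
    and mult :: "'a \<Rightarrow> 'a \<Rightarrow> 'a"
    and Basis :: "'a set"
  assumes "nonassoc_algebra scale mult"
    and "finite_dimensional_vector_space scale Basis"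
  shows "(nonassoc_algebra.L1_valued_uniform_square scale mult (\<lambda>a b. mult (mult a b) a) \<and>
          nonassoc_algebra.L1_valued_uniform_square scale mult (\<lambda>a b. mult a (mult b a)) \<longrightarrow>
          nonassoc_algebra.descendingly_flexible scale mult) \<and>
         (nonassoc_algebra.L1_valued_uniform_square scale mult (\<lambda>a b. mult (mult b a) a) \<and>
          nonassoc_algebra.L1_valued_uniform_square scale mult (\<lambda>a b. mult a (mult a b)) \<longrightarrow>
          nonassoc_algebra.descendingly_alternative scale mult)"
proof -
  interpret nonassoc_algebra scale mult
    by (rule assms(1))
  show ?thesis
    using descendingly_flexibleI descendingly_alternativeI by blast
qed

end
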